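(* Let $\alpha\in\mathbb C$ with $-\alpha\notin\mathbb N_0$, let $c,d\in\mathbb C\setminus\{0,1\}$, and let $x,t\in\mathbb C$. Then $$e^t\,{}_1F_1\!\left(\begin{matrix}-x\\ \alpha\end{matrix};\frac{t(1-c)}{c}\right)=\sum_{n=0}^{\infty}\frac{1}{n!}\,\Phi_2\!\left(-x,x;\alpha+n;\frac{t}{c},\frac{t}{d}\right)M_n(x;\alpha,d)\,t^n.$$
   Context: $\mathbb N_0=\{0,1,2,\dots\}$. Pochhammer symbol: $(a)_n=a(a+1)\cdots(a+n-1)$, $(a)_0=1$. ${}_1F_1\!\left(\begin{matrix}a\\ b\end{matrix};z\right)=\sum_{k\ge0}\frac{(a)_k}{(b)_k}\frac{z^k}{k!}$. Humbert series: $\Phi_2(\beta,\beta';\gamma;x,y)=\sum_{m,n\ge0}\frac{(\beta)_m(\beta')_n}{(\gamma)_{m+n}}\frac{x^m}{m!}\frac{y^n}{n!}$. Meixner polynomials (for $-\alpha\notin\mathbb N_0$, $d\ne0$): $M_n(x;\alpha,d)={}_2F_1\!\left(\begin{matrix}-n,\,-x\\ \alpha\end{matrix};1-\frac1d\right)=\sum_{k=0}^n\frac{(-n)_k(-x)_k}{(\alpha)_k\,k!}\left(1-\frac1d\right)^k$. *)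

theory Defs
  imports "HOL-Analysis.Analysis"
begin

definition hyp1F1 :: "complex \<Rightarrow> complex \<Rightarrow> complex \<Rightarrow> complex" where
  "hyp1F1 a b z = (\<Sum>k. pochhammer a k / pochhammer b k * (z ^ k / fact k))"

text \<open>
  The double series is an unordered sum over all pairs of indices. It converges absolutely
  for all \<open>x\<close>, \<open>y\<close> whenever \<open>- \<gamma> \<notin> \<nat>\<close>.
\<close>

definition humbert_Phi2 ::
  "complex \<Rightarrow> complex \<Rightarrow> complex \<Rightarrow> complex \<Rightarrow> complex \<Rightarrow> complex" where
  "humbert_Phi2 \<beta> \<beta>' \<gamma> x y =
     (\<Sum>\<^sub>\<infinity>(m, n)\<in>UNIV. pochhammer \<beta> m * pochhammer \<beta>' n / pochhammer \<gamma> (m + n)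
        * (x ^ m / fact m) * (y ^ n / fact n))"

definition meixner :: "nat \<Rightarrow> complex \<Rightarrow> complex \<Rightarrow> complex \<Rightarrow> complex" where
  "meixner n x \<alpha> d =
     (\<Sum>k=0..n. pochhammer (- of_nat n) k * pochhammer (- x) k / (pochhammer \<alpha> k * fact k)
        * (1 - 1 / d) ^ k)"

end

theory Submission
  imports Defs
begin

text \<open>
  The Meixner polynomials have two classical generating functions. The first is
  \<open>\<Sum>n. (\<alpha>)\<^sub>n / n! * M\<^sub>n(x; \<alpha>, d) * s^n = (1 - s/d)^x * (1 - s)^(- x - \<alpha>)\<close>
  (\<open>meixner_generating_function\<close>, a consequence of the Chu--Vandermonde identity). The parameter
  \<open>d\<close> occurs only in the first factor on the right, so the series for \<open>c\<close> is the
  series for \<open>d\<close> multiplied by \<open>(1 - s/c)^x * (1 - s/d)^(- x)\<close>. Comparing coefficients of \<open>s^N\<close>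
  expresses \<open>(\<alpha>)\<^sub>N / N! * M\<^sub>N(x; \<alpha>, c)\<close> through the \<open>(\<alpha>)\<^sub>n / n! * M\<^sub>n(x; \<alpha>, d)\<close> with
  \<open>n \<le> N\<close>; the connection coefficients are sums over \<open>m + k = N - n\<close> of the terms of a series
  \<open>\<Phi>\<^sub>2\<close> at \<open>(1/c, 1/d)\<close>, stripped of their denominators \<open>(\<gamma>)\<^bsub>m+k\<^esub>\<close>.

  The second is \<open>\<Sum>N. M\<^sub>N(x; \<alpha>, c) * t^N / N! = e^t * \<^sub>1F\<^sub>1(- x; \<alpha>; t (1 - c) / c)\<close>
  (\<open>meixner_exponential_generating_function\<close>), a Cauchy product. Inserting the connection formula
  here means giving the coefficient of \<open>s^N\<close> the weight \<open>t^N / (\<alpha>)\<^sub>N\<close>. The result is a triple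
  series over \<open>(n, m, k)\<close>. Summed along \<open>n + m + k = N\<close> first, it gives
  \<open>e^t * \<^sub>1F\<^sub>1\<close>; for fixed \<open>n\<close>, the equation
  \<open>(\<alpha>)\<^bsub>n+m+k\<^esub> = (\<alpha>)\<^sub>n * (\<alpha> + n)\<^bsub>m+k\<^esub>\<close> turns the sum over \<open>m\<close> and \<open>k\<close> into
  \<open>\<Phi>\<^sub>2\<close> with lower parameter \<open>\<alpha> + n\<close>.

  The two orders of summation agree by absolute convergence
  (\<open>fps_triple_product_weighted_sums\<close>): all the power series involved have geometrically bounded
  coefficients, whereas the weights decay like \<open>B^N / N!\<close>, since \<open>(\<alpha>)\<^sub>N\<close> grows
  like \<open>N!\<close> up to geometric factors.
\<close>

section \<open>Binomial series and the Chu--Vandermonde identity\<close>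

text \<open>The binomial series \<open>(1 - u X)^(- a)\<close>.\<close>

definition binomial_fps :: "complex \<Rightarrow> complex \<Rightarrow> complex fps" where
  "binomial_fps a u = Abs_fps (\<lambda>n. pochhammer a n / fact n * u ^ n)"

lemma binomial_fps_nth [simp]:
  "fps_nth (binomial_fps a u) n = pochhammer a n / fact n * u ^ n"
  by (simp add: binomial_fps_def)

lemma binomial_fps_0 [simp]: "binomial_fps 0 u = 1"
  by (rule fps_ext) (auto simp: pochhammer_0_left)

lemma binomial_fps_mult: "binomial_fps a u * binomial_fps b u = binomial_fps (a + b) u"
proof (rule fps_ext)
  fix n
  have "fps_nth (binomial_fps a u * binomial_fps b u) n =
        (\<Sum>k\<le>n. of_nat (n choose k) * pochhammer a k * pochhammer b (n - k) * (u ^ n / fact n))"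
    unfolding fps_mult_nth atLeast0AtMost
    by (intro sum.cong refl) (auto simp: binomial_fact field_simps simp flip: power_add)
  also have "\<dots> = fps_nth (binomial_fps (a + b) u) n"
    unfolding sum_distrib_right [symmetric] pochhammer_binomial_sum [symmetric] by simp
  finally show "fps_nth (binomial_fps a u * binomial_fps b u) n = fps_nth (binomial_fps (a + b) u) n" .
qed

text \<open>
  Reflecting \<open>(b + i)\<^bsub>N-i\<^esub> = (-1)^(N-i) * (1 - b - N)\<^bsub>N-i\<^esub>\<close> removes the dependence of the
  base on \<open>i\<close>, which leaves the Chu--Vandermonde sum with parameters \<open>a\<close> and \<open>1 - b - N\<close>.
\<close>

lemma Chu_Vandermonde_shifted:
  fixes a b :: complex
  shows "(\<Sum>i\<le>N. pochhammer a i * pochhammer (b + of_nat i) (N - i) * (-1) ^ i / (fact i * fact (N - i)))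
         = pochhammer (b - a) N / fact N"
proof -
  have reflect: "pochhammer (b + of_nat i) (N - i) = (-1) ^ N * (-1) ^ i * pochhammer (1 - b - of_nat N) (N - i)"
    if "i \<le> N" for i
    using pochhammer_minus'[of "b + of_nat N - 1" "N - i"] that
    by (simp add: of_nat_diff algebra_simps minus_one_power_iff)
  have "(\<Sum>i\<le>N. pochhammer a i * pochhammer (b + of_nat i) (N - i) * (-1) ^ i / (fact i * fact (N - i)))
      = (\<Sum>i\<le>N. of_nat (N choose i) * pochhammer a i * pochhammer (1 - b - of_nat N) (N - i)
                  * ((-1) ^ N / fact N))"
    by (intro sum.cong) (auto simp: reflect binomial_fact field_simps minus_one_power_iff)
  also have "\<dots> = pochhammer (a + (1 - b - of_nat N)) N * ((-1) ^ N / fact N)"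
    unfolding pochhammer_binomial_sum sum_distrib_right [symmetric] by simp
  also have "\<dots> = pochhammer (b - a) N / fact N"
    using pochhammer_minus'[of "b - a + of_nat N - 1" N] by (simp add: algebra_simps)
  finally show ?thesis .
qed

section \<open>Ordinary generating function of the Meixner polynomials\<close>

lemma pochhammer_nonzero:
  fixes \<alpha> :: complex
  assumes "- \<alpha> \<notin> \<nat>" shows "pochhammer \<alpha> n \<noteq> 0"
  using assms by (auto simp: pochhammer_eq_0_iff)

text \<open>
  Since \<open>(-n)\<^sub>k = (-1)^k * n! / (n - k)!\<close>, dividing by \<open>n!\<close> exhibits the Meixner polynomials as
  a convolution with the exponential series.
\<close>

lemma meixner_over_fact_eq_convolution:
  "meixner n x \<alpha> d / fact n =
     (\<Sum>k\<le>n. pochhammer (- x) k / (pochhammer \<alpha> k * fact k * fact (n - k)) * (1 / d - 1) ^ k)"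
proof -
  have "pochhammer (- of_nat n) k / fact n = (- 1) ^ k / (fact (n - k) :: complex)" if "k \<le> n" for k
  proof -
    have "pochhammer (of_nat n - of_nat k + 1) k * fact (n - k) = (fact n :: complex)"
      using pochhammer_product'[of "1::complex" "n - k" k] that
      by (simp add: pochhammer_fact of_nat_diff algebra_simps)
    then show ?thesis by (simp add: pochhammer_minus field_simps)
  qed
  note * = this
  have **: "(1 / d - 1) ^ k = (-1) ^ k * (1 - 1 / d) ^ k" for k
    by (simp flip: power_mult_distrib)
  show ?thesis
    unfolding meixner_def sum_divide_distrib atLeast0AtMost
  proof (intro sum.cong refl)
    fix k assume "k \<in> {..n}"
    have "pochhammer (- of_nat n) k * pochhammer (- x) k / (pochhammer \<alpha> k * fact k) * (1 - 1 / d) ^ k / fact n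
        = (pochhammer (- of_nat n) k / fact n) * (pochhammer (- x) k / (pochhammer \<alpha> k * fact k) * (1 - 1 / d) ^ k)"
      by (simp add: mult_ac)
    also have "\<dots> = (- 1) ^ k / fact (n - k) * (pochhammer (- x) k / (pochhammer \<alpha> k * fact k) * (1 - 1 / d) ^ k)"
      using * \<open>k \<in> {..n}\<close> by simp
    also have "\<dots> = pochhammer (- x) k / (pochhammer \<alpha> k * fact k * fact (n - k)) * (1 / d - 1) ^ k"
      unfolding ** by (simp add: mult_ac)
    finally show "pochhammer (- of_nat n) k * pochhammer (- x) k / (pochhammer \<alpha> k * fact k) * (1 - 1 / d) ^ k / fact n
        = pochhammer (- x) k / (pochhammer \<alpha> k * fact k * fact (n - k)) * (1 / d - 1) ^ k" .
  qed
qed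

text \<open>
  The left-hand side is a polynomial in \<open>u = 1 / d\<close>, given by its expansion in powers of \<open>u - 1\<close>.
  Re-expanding in powers of \<open>u\<close>, the coefficient of \<open>u^j\<close> is a Chu--Vandermonde sum with parameters
  \<open>- x + j\<close> and \<open>\<alpha> + j\<close>; their difference no longer contains \<open>j\<close>, which is why the result is
  a convolution.
\<close>

lemma meixner_generating_function:
  fixes \<alpha> :: complex
  assumes "- \<alpha> \<notin> \<nat>"
  shows "pochhammer \<alpha> n / fact n * meixner n x \<alpha> d =
         fps_nth (binomial_fps (- x) (1 / d) * binomial_fps (x + \<alpha>) 1) n"
proof -
  define u where "u = 1 / d"
  \<comment> \<open>The contribution to \<open>u^j\<close> of the term \<open>k = j + i\<close> of the Meixner sum.\<close>
  define g where "g j i = pochhammer (- x) (j + i) * pochhammer (\<alpha> + of_nat (j + i)) (n - (j + i))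
      / (fact (n - (j + i)) * (fact j * fact i)) * u ^ j * (-1) ^ i" for j i
  have "pochhammer \<alpha> n / fact n * meixner n x \<alpha> d = pochhammer \<alpha> n * (meixner n x \<alpha> d / fact n)"
    by simp
  also have "\<dots> = (\<Sum>k\<le>n. pochhammer (- x) k * pochhammer (\<alpha> + of_nat k) (n - k)
                         / (fact k * fact (n - k)) * (u - 1) ^ k)"
    unfolding meixner_over_fact_eq_convolution sum_distrib_left u_def
    by (intro sum.cong refl)
       (use pochhammer_nonzero[OF assms] in \<open>auto simp: pochhammer_product[where z = \<alpha>] field_simps\<close>)
  also have "\<dots> = (\<Sum>k\<le>n. \<Sum>j\<le>k. g j (k - j))"
  proof (intro sum.cong refl)
    fix k assume "k \<in> {..n}"
    have "(u - 1) ^ k = (\<Sum>j\<le>k. of_nat (k choose j) * u ^ j * (-1) ^ (k - j))"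
      using binomial_ring[of u "-1" k] by simp
    then show "pochhammer (- x) k * pochhammer (\<alpha> + of_nat k) (n - k) / (fact k * fact (n - k)) * (u - 1) ^ k
               = (\<Sum>j\<le>k. g j (k - j))"
      by (auto simp: sum_distrib_left g_def binomial_fact field_simps intro!: sum.cong)
  qed
  also have "\<dots> = (\<Sum>(j, i)\<in>{(j, i). j + i \<le> n}. g j i)"
    by (rule sum.triangle_reindex_eq [symmetric])
  also have "{(j, i). j + i \<le> n} = Sigma {..n} (\<lambda>j. {..n - j})"
    by auto
  also have "(\<Sum>(j, i)\<in>\<dots>. g j i) = (\<Sum>j\<le>n. \<Sum>i\<le>n - j. g j i)"
    by (rule sum.Sigma [symmetric]) auto
  also have "\<dots> = (\<Sum>j\<le>n. pochhammer (- x) j / fact j * u ^ j * (pochhammer (x + \<alpha>) (n - j) / fact (n - j)))"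
  proof (intro sum.cong refl)
    fix j assume "j \<in> {..n}"
    have "(\<Sum>i\<le>n - j. g j i) = pochhammer (- x) j / fact j * u ^ j *
       (\<Sum>i\<le>n - j. pochhammer (- x + of_nat j) i * pochhammer (\<alpha> + of_nat j + of_nat i) (n - j - i)
                    * (-1) ^ i / (fact i * fact (n - j - i)))"
      unfolding sum_distrib_left
      by (intro sum.cong refl)
         (simp add: g_def pochhammer_product'[of "- x" j] add.assoc divide_simps)
    then show "(\<Sum>i\<le>n - j. g j i) =
       pochhammer (- x) j / fact j * u ^ j * (pochhammer (x + \<alpha>) (n - j) / fact (n - j))"
      unfolding Chu_Vandermonde_shifted by (simp add: add.commute)
  qed
  finally show ?thesis
    by (simp add: fps_mult_nth atLeast0AtMost u_def)
qed

section \<open>Growth of Pochhammer symbols and of coefficients\<close>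

lemma norm_pochhammer_le: "norm (pochhammer (a::complex) n) \<le> (norm a + 1) ^ n * fact n"
proof (induction n)
  case (Suc n)
  have "norm (a + of_nat n) \<le> norm a + real n"
    using norm_triangle_ineq[of a "of_nat n"] by simp
  also have "\<dots> \<le> (norm a + 1) * real (Suc n)"
    by (simp add: algebra_simps)
  finally have "norm (a + of_nat n) * norm (pochhammer a n)
      \<le> ((norm a + 1) * real (Suc n)) * ((norm a + 1) ^ n * fact n)"
    using Suc.IH by (intro mult_mono) auto
  then show ?case
    by (simp only: pochhammer_rec' norm_mult fact_Suc power_Suc of_nat_mult) (simp only: mult_ac)
qed auto

lemma norm_binomial_fps_nth_le: "norm (fps_nth (binomial_fps a u) n) \<le> ((norm a + 1) * norm u) ^ n"
proof -
  have "norm (pochhammer a n) / fact n \<le> (norm a + 1) ^ n"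
    using norm_pochhammer_le[of a n] by (simp add: field_simps)
  from mult_right_mono[OF this, of "norm u ^ n"] show ?thesis
    by (simp add: norm_mult norm_divide norm_power power_mult_distrib)
qed

text \<open>
  The quotients \<open>(j + 1) / (\<alpha> + j)\<close> of consecutive factors of \<open>n!\<close> and \<open>(\<alpha>)\<^sub>n\<close> tend to \<open>1\<close>
  and are all defined, so they are bounded by some \<open>K\<close>.
\<close>

lemma norm_inverse_pochhammer_le:
  fixes \<alpha> :: complex
  assumes "- \<alpha> \<notin> \<nat>"
  obtains K where "K \<ge> 0" "\<And>n. norm (1 / pochhammer \<alpha> n) \<le> K ^ n / fact n"
proof -
  have nz: "\<alpha> + of_nat j \<noteq> 0" for j
    using assms by (metis of_nat_in_Nats minus_unique add.commute minus_minus)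
  have "eventually (\<lambda>j. norm (of_nat (Suc j) / (\<alpha> + of_nat j)) \<le> norm (2::complex)) sequentially"
    using eventually_ge_at_top[of "nat \<lceil>2 * norm \<alpha> + 1\<rceil>"]
  proof eventually_elim
    case (elim j)
    have "real j \<le> norm (\<alpha> + of_nat j) + norm \<alpha>"
      using norm_triangle_ineq4[of "\<alpha> + of_nat j" \<alpha>] by simp
    moreover have "2 * norm \<alpha> + 1 \<le> real j"
      using elim by linarith
    ultimately have "1 + real j \<le> 2 * norm (\<alpha> + of_nat j)"
      by linarith
    moreover have "norm (of_nat (Suc j) :: complex) = 1 + real j"
      using norm_of_nat[of "Suc j"] by simp
    ultimately show ?case
      using nz[of j] by (simp add: norm_divide divide_simps del: of_nat_Suc)
  qed
  then have "Bseq (\<lambda>j. of_nat (Suc j) / (\<alpha> + of_nat j))"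
    by (rule Bseq_eventually_mono) simp
  then obtain K where "K > 0" and K: "\<And>j. norm (of_nat (Suc j) / (\<alpha> + of_nat j)) \<le> K"
    by (auto elim: BseqE)
  have "norm (1 / pochhammer \<alpha> n) \<le> K ^ n / fact n" for n
  proof -
    have "norm (fact n / pochhammer \<alpha> n) \<le> K ^ n"
    proof (induction n)
      case (Suc n)
      have "fact (Suc n) / pochhammer \<alpha> (Suc n) =
            (of_nat (Suc n) / (\<alpha> + of_nat n)) * (fact n / pochhammer \<alpha> n)"
        by (simp add: pochhammer_rec')
      then show ?case
        using mult_mono[OF K[of n] Suc.IH] \<open>K > 0\<close> by (simp only: norm_mult power_Suc) simp
    qed auto
    then show ?thesis by (simp add: norm_divide field_simps)
  qed
  with \<open>K > 0\<close> that[of K] show ?thesis by simp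
qed

lemma norm_fps_mult_nth_le:
  fixes F G :: "complex fps"
  assumes "\<And>n. norm (fps_nth F n) \<le> R ^ n" "\<And>n. norm (fps_nth G n) \<le> S ^ n"
    and "R \<ge> 0" "S \<ge> 0"
  shows "norm (fps_nth (F * G) n) \<le> (2 * max R S) ^ n"
proof -
  let ?M = "max R S"
  have "norm (fps_nth (F * G) n) \<le> (\<Sum>i=0..n. norm (fps_nth F i * fps_nth G (n - i)))"
    unfolding fps_mult_nth by (rule norm_sum)
  also have "\<dots> \<le> (\<Sum>i=0..n. ?M ^ n)"
  proof (rule sum_mono)
    fix i assume "i \<in> {0..n}"
    have "norm (fps_nth F i * fps_nth G (n - i)) \<le> R ^ i * S ^ (n - i)"
      using assms by (simp add: norm_mult mult_mono)
    also have "\<dots> \<le> ?M ^ i * ?M ^ (n - i)"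
      using assms(3,4) by (intro mult_mono power_mono) auto
    also have "\<dots> = ?M ^ n"
      using \<open>i \<in> {0..n}\<close> by (simp flip: power_add)
    finally show "norm (fps_nth F i * fps_nth G (n - i)) \<le> ?M ^ n" .
  qed
  also have "\<dots> = real (Suc n) * ?M ^ n"
    by simp
  \<comment> \<open>The number of terms is absorbed into the base, to keep the bound purely geometric.\<close>
  also have "\<dots> \<le> 2 ^ n * ?M ^ n"
  proof (rule mult_right_mono)
    show "real (Suc n) \<le> 2 ^ n"
      by (metis Suc_leI less_exp numeral_power_le_of_nat_cancel_iff of_nat_le_iff of_nat_numeral of_nat_power)
  qed (use assms(3) in auto)
  finally show ?thesis by (simp add: power_mult_distrib)
qed

section \<open>Rearranging a triple series\<close>

lemma summable_on_mult_Times: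
  fixes f g :: "_ \<Rightarrow> real"
  assumes "f summable_on A" "g summable_on B" "\<And>x. f x \<ge> 0" "\<And>y. g y \<ge> 0"
  shows "(\<lambda>(x, y). f x * g y) summable_on A \<times> B"
proof (rule summable_on_SigmaI)
  show "((\<lambda>y. case (x, y) of (x, y) \<Rightarrow> f x * g y) has_sum f x * infsum g B) B" for x
    using has_sum_cmult_right[OF has_sum_infsum[OF assms(2)], of "f x"] by simp
  show "(\<lambda>x. f x * infsum g B) summable_on A"
    by (intro summable_on_cmult_left assms)
qed (use assms in auto)

lemma exp_series_summable_on: "B \<ge> 0 \<Longrightarrow> (\<lambda>n. B ^ n / fact n :: real) summable_on UNIV"
  using summable_norm_exp[of B]
  by (intro norm_summable_imp_summable_on) (simp add: divide_inverse mult.commute)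

text \<open>
  The hypothesis on \<open>L\<close> sums the family \<open>F\<^sub>n * G\<^sub>m * H\<^sub>k * w\<^bsub>n+m+k\<^esub>\<close> along \<open>n + m + k = N\<close>,
  the conclusion sums it over \<open>m\<close> and \<open>k\<close> for fixed \<open>n\<close>. The family is absolutely summable because \<open>n! * m! * k! \<le> (n + m + k)!\<close>, which makes
  a product of three exponential series a majorant.
\<close>

lemma fps_triple_product_weighted_sums:
  fixes F G H :: "complex fps" and w :: "nat \<Rightarrow> complex"
  assumes F: "\<And>n. norm (fps_nth F n) \<le> R ^ n" and G: "\<And>n. norm (fps_nth G n) \<le> S ^ n"
    and H: "\<And>n. norm (fps_nth H n) \<le> T ^ n" and w: "\<And>n. norm (w n) \<le> K ^ n / fact n"
    and nonneg: "R \<ge> 0" "S \<ge> 0" "T \<ge> 0" "K \<ge> 0"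
    and lim: "(\<lambda>N. fps_nth (F * (G * H)) N * w N) sums L"
  shows "(\<lambda>n. fps_nth F n * (\<Sum>\<^sub>\<infinity>(m, k)\<in>UNIV. fps_nth G m * fps_nth H k * w (n + m + k))) sums L"
proof -
  define f where "f = (\<lambda>(n, m, k). fps_nth F n * (fps_nth G m * fps_nth H k * w (n + m + k)))"
  have "(\<lambda>p. norm (f p)) summable_on UNIV"
  proof (rule Infinite_Sum.abs_summable_on_comparison_test')
    let ?g = "\<lambda>(n, m, k). (R * K) ^ n / fact n * ((S * K) ^ m / fact m * ((T * K) ^ k / fact k))"
    have "(\<lambda>(n, p). (R * K) ^ n / fact n * ((\<lambda>(m, k). (S * K) ^ m / fact m * ((T * K) ^ k / fact k)) p))
          summable_on UNIV \<times> UNIV \<times> UNIV"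
      using nonneg by (intro summable_on_mult_Times exp_series_summable_on) auto
    then show "?g summable_on UNIV"
      by (simp add: case_prod_unfold)
    fix p :: "nat \<times> nat \<times> nat"
    obtain n m k where p: "p = (n, m, k)" by (cases p)
    have "fact n * fact m dvd (fact (n + m) :: nat)" "fact (n + m) * fact k dvd (fact (n + m + k) :: nat)"
      by (rule fact_fact_dvd_fact)+
    then have "fact n * fact m * fact k dvd (fact (n + m + k) :: nat)"
      by (meson dvd_refl dvd_trans mult_dvd_mono)
    then have "fact n * fact m * fact k \<le> (fact (n + m + k) :: nat)"
      by (rule dvd_imp_le) simp
    then have "real (fact n * fact m * fact k) \<le> real (fact (n + m + k))"
      by (simp only: of_nat_le_iff)
    then have fact: "fact n * fact m * fact k \<le> (fact (n + m + k) :: real)"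
      by simp
    have "norm (f p) = norm (fps_nth F n) * (norm (fps_nth G m) * norm (fps_nth H k) * norm (w (n + m + k)))"
      by (simp add: f_def p norm_mult)
    also have "\<dots> \<le> R ^ n * (S ^ m * T ^ k * (K ^ (n + m + k) / fact (n + m + k)))"
      using nonneg by (intro mult_mono F G H w) auto
    also have "\<dots> \<le> R ^ n * (S ^ m * T ^ k * (K ^ (n + m + k) / (fact n * fact m * fact k)))"
      using nonneg fact by (intro mult_left_mono divide_left_mono) auto
    also have "\<dots> = ?g p"
      by (simp add: p power_add power_mult_distrib mult_ac)
    finally show "norm (f p) \<le> ?g p" .
  qed
  then have summable: "f summable_on UNIV \<times> UNIV"
    by (simp add: Infinite_Sum.abs_summable_summable)
  then obtain L' where L': "(f has_sum L') (UNIV \<times> UNIV)"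
    using has_sum_infsum by blast
  have "((\<lambda>n. fps_nth F n * (\<Sum>\<^sub>\<infinity>(m, k)\<in>UNIV. fps_nth G m * fps_nth H k * w (n + m + k))) has_sum L') UNIV"
  proof (rule has_sum_SigmaD[OF L'])
    fix n :: nat
    have "(\<lambda>p. f (n, p)) summable_on UNIV"
      using summable_on_SigmaD1[of "\<lambda>n p. f (n, p)" UNIV "\<lambda>_. UNIV" n] summable by simp
    then have "((\<lambda>p. f (n, p)) has_sum (\<Sum>\<^sub>\<infinity>p. f (n, p))) UNIV"
      by (rule has_sum_infsum)
    also have "(\<Sum>\<^sub>\<infinity>p. f (n, p)) = fps_nth F n * (\<Sum>\<^sub>\<infinity>(m, k)\<in>UNIV. fps_nth G m * fps_nth H k * w (n + m + k))"
      by (simp add: f_def case_prod_unfold infsum_cmult_right')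
    finally show "((\<lambda>p. f (n, p)) has_sum \<dots>) UNIV" .
  qed
  moreover have "((\<lambda>N. fps_nth (F * (G * H)) N * w N) has_sum L') UNIV"
  proof (rule has_sum_SigmaD)
    define D :: "nat \<Rightarrow> (nat \<times> nat \<times> nat) set" where "D N = {(n, m, k). n + m + k = N}" for N
    have "bij_betw snd (Sigma UNIV D) (UNIV \<times> UNIV)"
      by (rule bij_betw_byWitness[where f' = "\<lambda>(n, m, k). (n + m + k, n, m, k)"]) (auto simp: D_def)
    from has_sum_reindex_bij_betw[OF this, of f L'] L'
    show "((\<lambda>q. f (snd q)) has_sum L') (Sigma UNIV D)" by simp
    fix N
    have D_eq: "D N = (\<lambda>(n, m). (n, m, N - n - m)) ` (SIGMA n:{0..N}. {0..N - n})"
      by (auto simp: D_def image_iff)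
    have "(\<Sum>p\<in>D N. f p) = (\<Sum>(n, m)\<in>(SIGMA n:{0..N}. {0..N - n}). f (n, m, N - n - m))"
      unfolding D_eq by (subst sum.reindex) (auto simp: inj_on_def case_prod_unfold)
    also have "\<dots> = (\<Sum>n=0..N. \<Sum>m=0..N - n. f (n, m, N - n - m))"
      by (rule sum.Sigma [symmetric]) auto
    also have "\<dots> = fps_nth (F * (G * H)) N * w N"
      unfolding fps_mult_nth sum_distrib_left sum_distrib_right f_def
      by (intro sum.cong refl) (auto simp: mult_ac)
    finally show "((\<lambda>p. f (snd (N, p))) has_sum fps_nth (F * (G * H)) N * w N) (D N)"
      by (intro has_sum_finiteI) (auto simp: D_eq)
  qed
  ultimately show ?thesis
    using lim has_sum_imp_sums sums_unique2 by blast
qed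

section \<open>Exponential generating function and the expansion in \<open>\<Phi>\<^sub>2\<close>\<close>

text \<open>
  The convolution in \<open>meixner_over_fact_eq_convolution\<close> is the Cauchy product of the
  \<open>\<^sub>1F\<^sub>1\<close> series with the exponential series.
\<close>

lemma meixner_exponential_generating_function:
  fixes \<alpha> :: complex
  assumes "- \<alpha> \<notin> \<nat>"
  shows "(\<lambda>n. meixner n x \<alpha> d / fact n * t ^ n) sums (exp t * hyp1F1 (- x) \<alpha> (t * (1 / d - 1)))"
proof -
  define z where "z = t * (1 / d - 1)"
  define a where "a k = pochhammer (- x) k / pochhammer \<alpha> k * (z ^ k / fact k)" for k
  obtain K where K: "K \<ge> 0" "\<And>n. norm (1 / pochhammer \<alpha> n) \<le> K ^ n / fact n"
    using norm_inverse_pochhammer_le[OF assms] by blast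
  have "summable (\<lambda>k. norm (a k))"
  proof (rule summable_comparison_test')
    define B where "B = (norm x + 1) * K * norm z"
    show "summable (\<lambda>k. B ^ k / fact k)"
      using summable_exp[of B] by (simp add: divide_inverse mult.commute)
    fix k :: nat assume "k \<ge> 0"
    have "norm (pochhammer (- x) k) * norm (1 / pochhammer \<alpha> k) \<le>
          ((norm x + 1) ^ k * fact k) * (K ^ k / fact k)"
      using norm_pochhammer_le[of "- x" k] K by (intro mult_mono) auto
    from mult_right_mono[OF this, of "norm z ^ k / fact k"]
    show "norm (norm (a k)) \<le> B ^ k / fact k"
      by (simp add: a_def B_def norm_mult norm_divide norm_power power_mult_distrib)
  qed
  moreover have "summable (\<lambda>k. norm (t ^ k / fact k))"
    using summable_norm_exp[of t] by (simp add: scaleR_conv_of_real divide_inverse mult.commute)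
  ultimately have "(\<lambda>n. \<Sum>k\<le>n. a k * (t ^ (n - k) / fact (n - k))) sums ((\<Sum>k. a k) * (\<Sum>k. t ^ k / fact k))"
    by (rule Cauchy_product_sums)
  moreover have "(\<Sum>k. t ^ k / fact k) = exp t"
    by (simp add: exp_def scaleR_conv_of_real divide_inverse mult.commute)
  moreover have "(\<Sum>k\<le>n. a k * (t ^ (n - k) / fact (n - k))) = meixner n x \<alpha> d / fact n * t ^ n" for n
    unfolding meixner_over_fact_eq_convolution sum_distrib_right
  proof (intro sum.cong refl)
    fix k assume "k \<in> {..n}"
    then have "t ^ n = t ^ k * t ^ (n - k)"
      by (simp flip: power_add)
    then show "a k * (t ^ (n - k) / fact (n - k)) =
        pochhammer (- x) k / (pochhammer \<alpha> k * fact k * fact (n - k)) * (1 / d - 1) ^ k * t ^ n"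
      by (simp add: a_def z_def power_mult_distrib)
  qed
  ultimately show ?thesis
    by (simp add: hyp1F1_def a_def z_def mult.commute)
qed

theorem theorem9:
  fixes \<alpha> c d x t :: complex
  assumes "- \<alpha> \<notin> \<nat>"
    and "c \<notin> {0, 1}" and "d \<notin> {0, 1}"
  shows "(\<lambda>n. 1 / fact n * humbert_Phi2 (- x) x (\<alpha> + of_nat n) (t / c) (t / d)
              * meixner n x \<alpha> d * t ^ n)
         sums (exp t * hyp1F1 (- x) \<alpha> (t * (1 - c) / c))"
proof -
  define F where "F = binomial_fps (- x) (1 / d) * binomial_fps (x + \<alpha>) 1"
  define G where "G = binomial_fps (- x) (1 / c)"
  define H where "H = binomial_fps x (1 / d)"
  define w where "w n = t ^ n / pochhammer \<alpha> n" for n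
  note nz = pochhammer_nonzero[OF assms(1)]
  have F_nth: "fps_nth F n = pochhammer \<alpha> n / fact n * meixner n x \<alpha> d" for n
    unfolding F_def by (rule meixner_generating_function[OF assms(1), symmetric])
  \<comment> \<open>\<open>H\<close> is inverse to the factor of \<open>F\<close> that depends on \<open>d\<close>, and \<open>G\<close> is its counterpart
      for \<open>c\<close>: multiplying by \<open>G * H\<close> exchanges \<open>d\<close> for \<open>c\<close>.\<close>
  have "F * (G * H) = (binomial_fps (- x) (1 / d) * binomial_fps x (1 / d)) * (G * binomial_fps (x + \<alpha>) 1)"
    by (simp add: F_def H_def mult_ac)
  also have "\<dots> = binomial_fps (- x) (1 / c) * binomial_fps (x + \<alpha>) 1"
    by (simp add: binomial_fps_mult G_def)
  finally have FGH: "fps_nth (F * (G * H)) N = pochhammer \<alpha> N / fact N * meixner N x \<alpha> c" for N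
    by (simp only: meixner_generating_function[OF assms(1)])
  have "(\<lambda>N. fps_nth (F * (G * H)) N * w N) sums (exp t * hyp1F1 (- x) \<alpha> (t * (1 / c - 1)))"
    using meixner_exponential_generating_function[OF assms(1), of x c t] nz
    by (simp add: FGH w_def)
  also have "t * (1 / c - 1) = t * (1 - c) / c"
    using assms(2) by (simp add: field_simps)
  finally have lim: "(\<lambda>N. fps_nth (F * (G * H)) N * w N) sums (exp t * hyp1F1 (- x) \<alpha> (t * (1 - c) / c))" .
  obtain K where K: "K \<ge> 0" "\<And>n. norm (1 / pochhammer \<alpha> n) \<le> K ^ n / fact n"
    using norm_inverse_pochhammer_le[OF assms(1)] by blast
  have w: "norm (w n) \<le> (norm t * K) ^ n / fact n" for n
    using mult_left_mono[OF K(2)[of n], of "norm t ^ n"]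
    by (simp add: w_def norm_divide norm_power power_mult_distrib)
  obtain R where "R \<ge> 0" and R: "\<And>n. norm (fps_nth F n) \<le> R ^ n"
  proof
    show "norm (fps_nth F n) \<le> (2 * max ((norm (- x) + 1) * norm (1 / d))
            ((norm (x + \<alpha>) + 1) * norm (1 :: complex))) ^ n" for n
      unfolding F_def by (intro norm_fps_mult_nth_le norm_binomial_fps_nth_le) auto
  qed (simp add: max_def)
  have *: "(\<lambda>n. fps_nth F n * (\<Sum>\<^sub>\<infinity>(m, k)\<in>UNIV. fps_nth G m * fps_nth H k * w (n + m + k)))
        sums (exp t * hyp1F1 (- x) \<alpha> (t * (1 - c) / c))"
    by (rule fps_triple_product_weighted_sums[OF R
          norm_binomial_fps_nth_le[of "- x" "1 / c", folded G_def]
          norm_binomial_fps_nth_le[of x "1 / d", folded H_def] w _ _ _ _ lim])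
       (use K(1) \<open>R \<ge> 0\<close> in auto)
  have Phi2: "(\<Sum>\<^sub>\<infinity>(m, k)\<in>UNIV. fps_nth G m * fps_nth H k * w (n + m + k)) =
        t ^ n / pochhammer \<alpha> n * humbert_Phi2 (- x) x (\<alpha> + of_nat n) (t / c) (t / d)" for n
  proof -
    have "fps_nth G m * fps_nth H k * w (n + m + k) = t ^ n / pochhammer \<alpha> n *
          (pochhammer (- x) m * pochhammer x k / pochhammer (\<alpha> + of_nat n) (m + k)
            * ((t / c) ^ m / fact m) * ((t / d) ^ k / fact k))" for m k
      by (simp add: G_def H_def w_def add.assoc pochhammer_product' power_add power_divide mult_ac)
    then show ?thesis
      unfolding humbert_Phi2_def by (simp only: case_prod_unfold infsum_cmult_right')
  qed
  have "fps_nth F n * (\<Sum>\<^sub>\<infinity>(m, k)\<in>UNIV. fps_nth G m * fps_nth H k * w (n + m + k)) =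
        1 / fact n * humbert_Phi2 (- x) x (\<alpha> + of_nat n) (t / c) (t / d) * meixner n x \<alpha> d * t ^ n" for n
    unfolding Phi2 F_nth using nz[of n] by simp
  with * show ?thesis by simp
qed

end
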